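(* Let $q\in\{2,3,4\}$, let $W$ be an $\mathbb{F}_q$-weighing matrix $\mathrm{W}(n,m;\mathbb{F}_q)$, and let $G$ be a permutation automorphism group of $W$ acting with $t$ orbits on the rows and $t$ orbits on the columns of $W$, all of the same length. Let $B$ be the $t\times b$ point-by-block incidence matrix of an $(r,\lambda)$-design, and let $R$ be the row orbit matrix of $W$ with respect to $G$. If $r+(t-1)\lambda+m\neq 0$ and $r-\lambda+m\neq 0$ in $\mathbb{F}_q$, then $A=[\,R\mid B\,]$ generates a Hermitian LCD code $C$ of length $t+b$ over $\mathbb{F}_q$.
   Context: For $x\in\mathbb{F}_q$ put $x^{\dagger}=0$ if $x=0$ and $x^{\dagger}=x^{-1}$ otherwise. For a matrix $M=[m_{ij}]$ over $\mathbb{F}_q$, $M^{*}=[m_{ji}^{\dagger}]$; for a vector $v=[v_0,\dots,v_{N-1}]$, $v^{*}=[v_0^{\dagger},\dots,v_{N-1}^{\dagger}]$. An $\mathbb{F}_q$-weighing matrix $\mathrm{W}(n,m;\mathbb{F}_q)$ is an $n\times n$ matrix $W$ over $\mathbb{F}_q$ with exactly $m$ non-zero entries in each row and column such that $WW^{*}=mI_n$ over $\mathbb{F}_q$. A permutation automorphism of an $n\times n$ matrix $M$ is a pair $(P,Q)$ of permutation matrices with $PMQ^{\top}=M$; these form a group $\mathrm{PAut}(M)$ under $(P,Q)(R,S)=(PR,QS)$, and a permutation automorphism group of $M$ is a subgroup $G\le\mathrm{PAut}(M)$; it acts on the rows (via $P$) and on the columns (via $Q$). Let $\mathcal{R}_1,\dots,\mathcal{R}_t$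 and $\mathcal{C}_1,\dots,\mathcal{C}_t$ be the $G$-orbits on rows and columns, and let $M_{ij}$ be the submatrix of $M$ with rows in $\mathcal{R}_i$ and columns in $\mathcal{C}_j$. All rows of $M_{ij}$ have the same sum $\Gamma_{ij}$ (computed in $\mathbb{F}_q$); the row orbit matrix is the $t\times t$ matrix $R=[\Gamma_{ij}]$ over $\mathbb{F}_q$. An $(r,\lambda)$-design is a finite set of points with a collection of $b$ subsets (blocks) such that each point lies in exactly $r$ blocks and every pair of distinct points lies together in exactly $\lambda$ blocks; its point-by-block incidence matrix is the $(0,1)$-matrix with rows indexed by points, columns by blocks, and entry $1$ exactly when the point lies in the block. Integers are interpreted in $\mathbb{F}_q$. A matrix over $\mathbb{F}_q$ generates the linear code spanned by its rows. The Hermitian dual $C^{H}$ of a linear code $C\subseteq\mathbb{F}_q^N$ is its orthogonal complement under $\langle u,v\rangle_I=u\cdot v^{*}$ (for $q=4$ this is the usual Hermitian dual; for $q\in\{2,3\}$ it is the Euclidean dual), and $C$ is Hermitian LCD if $C\cap C^{H}=\{0\}$. *)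

theory Defs
  imports "HOL-Algebra.Group_Action" "Jordan_Normal_Form.VS_Connect"
begin

definition dagger :: "'a::field \<Rightarrow> 'a" where
  "dagger x = (if x = 0 then 0 else inverse x)"

definition star_mat :: "'a::field mat \<Rightarrow> 'a mat" where
  "star_mat M = mat (dim_col M) (dim_row M) (\<lambda>(i, j). dagger (M $$ (j, i)))"

definition star_vec :: "'a::field vec \<Rightarrow> 'a vec" where
  "star_vec v = vec (dim_vec v) (\<lambda>i. dagger (v $ i))"

definition weighing_matrix :: "nat \<Rightarrow> nat \<Rightarrow> 'a::field mat \<Rightarrow> bool" where
  "weighing_matrix n m W \<longleftrightarrow>
     W \<in> carrier_mat n n \<and>
     (\<forall>i<n. card {j. j < n \<and> W $$ (i, j) \<noteq> 0} = m) \<and>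
     (\<forall>j<n. card {i. i < n \<and> W $$ (i, j) \<noteq> 0} = m) \<and>
     W * star_mat W = of_nat m \<cdot>\<^sub>m 1\<^sub>m n"

definition perm_mat :: "nat \<Rightarrow> (nat \<Rightarrow> nat) \<Rightarrow> 'a::field mat" where
  "perm_mat n p = mat n n (\<lambda>(i, j). if i = p j then 1 else 0)"

definition permutation_matrix :: "nat \<Rightarrow> 'a::field mat \<Rightarrow> bool" where
  "permutation_matrix n P \<longleftrightarrow> (\<exists>p. p permutes {..<n} \<and> P = perm_mat n p)"

definition PAut :: "nat \<Rightarrow> 'a::field mat \<Rightarrow> ('a mat \<times> 'a mat) monoid" where
  "PAut n M = \<lparr>carrier = {(P, Q). permutation_matrix n P \<and> permutation_matrix n Q \<and>
                               P * M * Q\<^sup>T = M},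
              mult = (\<lambda>(P, Q) (R, S). (P * R, Q * S)),
              one = (1\<^sub>m n, 1\<^sub>m n)\<rparr>"

text \<open>In \<open>P * M * Q\<^sup>T\<close>, row \<open>j\<close> of \<open>M\<close> is moved to the position \<open>i\<close> for which
  \<open>P $$ (i, j) = 1\<close>, and likewise for the columns of \<open>M\<close> with \<open>Q\<close> in place of \<open>P\<close>.\<close>

definition perm_mat_act :: "nat \<Rightarrow> 'a::field mat \<Rightarrow> nat \<Rightarrow> nat" where
  "perm_mat_act n P = (\<lambda>j\<in>{..<n}. THE i. i < n \<and> P $$ (i, j) = 1)"

definition row_act :: "nat \<Rightarrow> 'a::field mat \<times> 'a mat \<Rightarrow> nat \<Rightarrow> nat" where
  "row_act n g = perm_mat_act n (fst g)"

definition col_act :: "nat \<Rightarrow> 'a::field mat \<times> 'a mat \<Rightarrow> nat \<Rightarrow> nat" where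
  "col_act n g = perm_mat_act n (snd g)"

definition row_orbits :: "nat \<Rightarrow> 'a::field mat \<Rightarrow> ('a mat \<times> 'a mat) set \<Rightarrow> nat set set" where
  "row_orbits n M G = orbits (PAut n M\<lparr>carrier := G\<rparr>) {..<n} (row_act n)"

definition col_orbits :: "nat \<Rightarrow> 'a::field mat \<Rightarrow> ('a mat \<times> 'a mat) set \<Rightarrow> nat set set" where
  "col_orbits n M G = orbits (PAut n M\<lparr>carrier := G\<rparr>) {..<n} (col_act n)"

text \<open>\<open>\<R> 0, \<dots>, \<R> (t - 1)\<close> and \<open>\<C> 0, \<dots>, \<C> (t - 1)\<close> enumerate the row and column orbits; the
  definite description is the common row sum of the submatrix on \<open>\<R> i\<close> and \<open>\<C> j\<close>, which exists
  by \<open>row_sum_exists\<close> below.\<close>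

definition row_orbit_matrix ::
    "nat \<Rightarrow> (nat \<Rightarrow> nat set) \<Rightarrow> (nat \<Rightarrow> nat set) \<Rightarrow> 'a::field mat \<Rightarrow> 'a mat" where
  "row_orbit_matrix t \<R> \<C> M =
     mat t t (\<lambda>(i, j). THE s. \<forall>x\<in>\<R> i. (\<Sum>y\<in>\<C> j. M $$ (x, y)) = s)"

lemma perm_mat_carrier [simp]: "perm_mat n p \<in> carrier_mat n n"
  by (simp add: perm_mat_def)

lemma perm_mat_id: "perm_mat n id = 1\<^sub>m n"
  by (rule eq_matI) (auto simp: perm_mat_def)

lemma perm_mat_mult:
  assumes "q permutes {..<n}"
  shows "perm_mat n p * perm_mat n q = (perm_mat n (p \<circ> q) :: 'a::field mat)"
proof (rule eq_matI)
  fix i j assume "i < dim_row (perm_mat n (p \<circ> q) :: 'a mat)"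
    "j < dim_col (perm_mat n (p \<circ> q) :: 'a mat)"
  hence ij: "i < n" "j < n" by (auto simp: perm_mat_def)
  have qj: "q j < n" using permutes_in_image[OF assms, of j] ij by simp
  have "(perm_mat n p * perm_mat n q) $$ (i, j) =
      (\<Sum>k\<in>{0..<n}. (if i = p k then 1 else 0) * (if k = q j then 1 else (0::'a)))"
    using ij by (simp add: perm_mat_def scalar_prod_def)
  also have "\<dots> = (\<Sum>k\<in>{0..<n}. if k = q j then (if i = p k then 1 else 0) else 0)"
    by (rule sum.cong) auto
  also have "\<dots> = (if i = p (q j) then 1 else 0)" using qj by simp
  finally show "(perm_mat n p * perm_mat n q) $$ (i, j) = (perm_mat n (p \<circ> q) :: 'a mat) $$ (i, j)"
    using ij by (simp add: perm_mat_def)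
qed (auto simp: perm_mat_def)

lemma perm_mat_conj_index:
  fixes M :: "'a::field mat"
  assumes "p permutes {..<n}" "q permutes {..<n}" "M \<in> carrier_mat n n" "a < n" "b < n"
  shows "(perm_mat n p * M * (perm_mat n q)\<^sup>T) $$ (p a, q b) = M $$ (a, b)"
proof -
  have pa: "p a < n" and qb: "q b < n"
    using permutes_in_image[OF assms(1), of a] permutes_in_image[OF assms(2), of b] assms by auto
  have 1: "(perm_mat n p * M) $$ (p a, l) = M $$ (a, l)" if "l < n" for l
  proof -
    have "(perm_mat n p * M) $$ (p a, l) =
        (\<Sum>k\<in>{0..<n}. (if p a = p k then 1 else 0) * M $$ (k, l))"
      using that pa assms(3) by (simp add: perm_mat_def scalar_prod_def)
    also have "\<dots> = (\<Sum>k\<in>{0..<n}. if k = a then M $$ (k, l) else 0)"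
      by (rule sum.cong) (auto simp: inj_eq[OF permutes_inj[OF assms(1)]])
    finally show ?thesis using assms(4) by simp
  qed
  have "(perm_mat n p * M * (perm_mat n q)\<^sup>T) $$ (p a, q b) =
      (\<Sum>l\<in>{0..<n}. (perm_mat n p * M) $$ (p a, l) * (perm_mat n q)\<^sup>T $$ (l, q b))"
    using pa qb assms(3) by (simp add: perm_mat_def scalar_prod_def)
  also have "\<dots> = (\<Sum>l\<in>{0..<n}. M $$ (a, l) * (if q b = q l then 1 else 0))"
    using qb by (intro sum.cong refl) (simp only: 1 atLeastLessThan_iff, simp add: perm_mat_def)
  also have "\<dots> = (\<Sum>l\<in>{0..<n}. if l = b then M $$ (a, l) else 0)"
    by (rule sum.cong) (auto simp: inj_eq[OF permutes_inj[OF assms(2)]])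
  finally show ?thesis using assms(5) by simp
qed

lemma perm_mat_conj_eq_iff:
  fixes M :: "'a::field mat"
  assumes "p permutes {..<n}" "q permutes {..<n}" "M \<in> carrier_mat n n"
  shows "perm_mat n p * M * (perm_mat n q)\<^sup>T = M \<longleftrightarrow>
    (\<forall>a<n. \<forall>b<n. M $$ (p a, q b) = M $$ (a, b))" (is "?L = M \<longleftrightarrow> ?R")
proof
  show "?L = M \<Longrightarrow> ?R" using perm_mat_conj_index[OF assms] by simp
next
  assume R: ?R
  show "?L = M"
  proof (rule eq_matI)
    fix i j assume "i < dim_row M" "j < dim_col M"
    hence ij: "i < n" "j < n" using assms(3) by auto
    obtain a b where ab: "i = p a" "j = q b" "a < n" "b < n"
      using ij permutes_image[OF assms(1)] permutes_image[OF assms(2)]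
      by (metis imageE lessThan_iff)
    show "?L $$ (i, j) = M $$ (i, j)"
      unfolding ab(1,2) using perm_mat_conj_index[OF assms ab(3,4)] R ab(3,4) by simp
  qed (use assms(3) in \<open>auto simp: perm_mat_def\<close>)
qed

lemma perm_mat_act_perm_mat:
  assumes "p permutes {..<n}"
  shows "perm_mat_act n (perm_mat n p :: 'a::field mat) = restrict p {..<n}"
proof -
  have "(THE i. i < n \<and> (perm_mat n p :: 'a mat) $$ (i, j) = 1) = p j" if "j < n" for j
    by (rule the_equality)
      (use that permutes_in_image[OF assms, of j] in \<open>auto simp: perm_mat_def split: if_splits\<close>)
  thus ?thesis by (auto simp: perm_mat_act_def)
qed

lemma PAut_carrier_iff:
  fixes M :: "'a::field mat"
  assumes "M \<in> carrier_mat n n"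
  shows "g \<in> carrier (PAut n M) \<longleftrightarrow> (\<exists>p q. p permutes {..<n} \<and> q permutes {..<n} \<and>
    g = (perm_mat n p, perm_mat n q) \<and> (\<forall>a<n. \<forall>b<n. M $$ (p a, q b) = M $$ (a, b)))"
proof
  assume "g \<in> carrier (PAut n M)"
  then obtain p q where "p permutes {..<n}" "q permutes {..<n}" "g = (perm_mat n p, perm_mat n q)"
    "perm_mat n p * M * (perm_mat n q)\<^sup>T = M"
    by (auto simp: PAut_def permutation_matrix_def)
  thus "\<exists>p q. p permutes {..<n} \<and> q permutes {..<n} \<and>
    g = (perm_mat n p, perm_mat n q) \<and> (\<forall>a<n. \<forall>b<n. M $$ (p a, q b) = M $$ (a, b))"
    using perm_mat_conj_eq_iff[OF _ _ assms] by blast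
next
  assume "\<exists>p q. p permutes {..<n} \<and> q permutes {..<n} \<and>
    g = (perm_mat n p, perm_mat n q) \<and> (\<forall>a<n. \<forall>b<n. M $$ (p a, q b) = M $$ (a, b))"
  then obtain p q where pq: "p permutes {..<n}" "q permutes {..<n}"
    "g = (perm_mat n p, perm_mat n q)" "\<forall>a<n. \<forall>b<n. M $$ (p a, q b) = M $$ (a, b)" by blast
  have "perm_mat n p * M * (perm_mat n q)\<^sup>T = M"
    using perm_mat_conj_eq_iff[OF pq(1,2) assms] pq(4) by blast
  moreover have "permutation_matrix n (perm_mat n p :: 'a mat)"
    "permutation_matrix n (perm_mat n q :: 'a mat)"
    unfolding permutation_matrix_def using pq by blast+
  ultimately show "g \<in> carrier (PAut n M)" by (simp add: PAut_def pq(3))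
qed

lemma group_PAut:
  fixes M :: "'a::field mat"
  assumes M: "M \<in> carrier_mat n n"
  shows "group (PAut n M)"
proof (rule groupI)
  note iff = PAut_carrier_iff[OF M]
  fix x y assume x: "x \<in> carrier (PAut n M)" and y: "y \<in> carrier (PAut n M)"
  obtain p q where x': "p permutes {..<n}" "q permutes {..<n}" "x = (perm_mat n p, perm_mat n q)"
    "\<forall>a<n. \<forall>b<n. M $$ (p a, q b) = M $$ (a, b)" using x iff by blast
  obtain r s where y': "r permutes {..<n}" "s permutes {..<n}" "y = (perm_mat n r, perm_mat n s)"
    "\<forall>a<n. \<forall>b<n. M $$ (r a, s b) = M $$ (a, b)" using y iff by blast
  have "M $$ ((p \<circ> r) a, (q \<circ> s) b) = M $$ (a, b)" if "a < n" "b < n" for a b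
    using that x'(4) y'(4) permutes_in_image[OF y'(1), of a] permutes_in_image[OF y'(2), of b] by simp
  moreover have "x \<otimes>\<^bsub>PAut n M\<^esub> y = (perm_mat n (p \<circ> r), perm_mat n (q \<circ> s))"
    by (simp add: PAut_def x' y' perm_mat_mult)
  ultimately show "x \<otimes>\<^bsub>PAut n M\<^esub> y \<in> carrier (PAut n M)"
    unfolding iff using permutes_compose[OF y'(1) x'(1)] permutes_compose[OF y'(2) x'(2)] by blast
next
  show "\<one>\<^bsub>PAut n M\<^esub> \<in> carrier (PAut n M)"
    unfolding PAut_carrier_iff[OF M]
    by (rule exI[of _ id], rule exI[of _ id]) (simp add: PAut_def perm_mat_id permutes_id)
next
  fix x y z assume "x \<in> carrier (PAut n M)" "y \<in> carrier (PAut n M)" "z \<in> carrier (PAut n M)"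
  thus "x \<otimes>\<^bsub>PAut n M\<^esub> y \<otimes>\<^bsub>PAut n M\<^esub> z = x \<otimes>\<^bsub>PAut n M\<^esub> (y \<otimes>\<^bsub>PAut n M\<^esub> z)"
    by (auto simp: PAut_def permutation_matrix_def assoc_mult_mat[of _ n n _ n _ n])
next
  fix x assume "x \<in> carrier (PAut n M)"
  thus "\<one>\<^bsub>PAut n M\<^esub> \<otimes>\<^bsub>PAut n M\<^esub> x = x"
    by (auto simp: PAut_def permutation_matrix_def left_mult_one_mat[of _ n n])
next
  note iff = PAut_carrier_iff[OF M]
  fix x assume x: "x \<in> carrier (PAut n M)"
  obtain p q where x': "p permutes {..<n}" "q permutes {..<n}" "x = (perm_mat n p, perm_mat n q)"
    "\<forall>a<n. \<forall>b<n. M $$ (p a, q b) = M $$ (a, b)" using x iff by blast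
  let ?p = "inv_into UNIV p" and ?q = "inv_into UNIV q"
  let ?y = "(perm_mat n ?p, perm_mat n ?q) :: 'a mat \<times> 'a mat"
  have inv: "?p permutes {..<n}" "?q permutes {..<n}" using x' permutes_inv by auto
  have "M $$ (?p a, ?q b) = M $$ (a, b)" if "a < n" "b < n" for a b
    using that x'(4) permutes_in_image[OF inv(1), of a] permutes_in_image[OF inv(2), of b]
    by (metis lessThan_iff permutes_inverses(1) x'(1,2))
  hence "?y \<in> carrier (PAut n M)" unfolding iff using inv by blast
  moreover have "?y \<otimes>\<^bsub>PAut n M\<^esub> x = \<one>\<^bsub>PAut n M\<^esub>"
    using x'(1,2) by (simp add: PAut_def x'(3) perm_mat_mult permutes_inv_o perm_mat_id)
  ultimately show "\<exists>y\<in>carrier (PAut n M). y \<otimes>\<^bsub>PAut n M\<^esub> x = \<one>\<^bsub>PAut n M\<^esub>" by blast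
qed

lemma group_action_PAut:
  fixes M :: "'a::field mat"
  assumes M: "M \<in> carrier_mat n n"
  shows "group_action (PAut n M) {..<n} (row_act n)"
    and "group_action (PAut n M) {..<n} (col_act n)"
proof -
  have bij: "restrict p {..<n} \<in> Bij {..<n}" if "p permutes {..<n}" for p
    using that by (auto simp: Bij_def dest: permutes_imp_bij)
  have act: "perm_mat_act n P \<in> Bij {..<n}" if "permutation_matrix n P" for P :: "'a mat"
    using that bij by (auto simp: permutation_matrix_def perm_mat_act_perm_mat)
  have mult: "perm_mat_act n (P * Q) = compose {..<n} (perm_mat_act n P) (perm_mat_act n Q)"
    if PQ: "permutation_matrix n P" "permutation_matrix n Q" for P Q :: "'a mat"
  proof -
    obtain p q where "p permutes {..<n}" "P = perm_mat n p" "q permutes {..<n}" "Q = perm_mat n q"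
      using PQ by (auto simp: permutation_matrix_def)
    thus ?thesis using permutes_in_image[of q "{..<n}"]
      by (simp add: perm_mat_mult perm_mat_act_perm_mat permutes_compose compose_def fun_eq_iff)
  qed
  have "row_act n \<in> hom (PAut n M) (BijGroup {..<n})"
       "col_act n \<in> hom (PAut n M) (BijGroup {..<n})"
    by (auto intro!: homI simp: row_act_def col_act_def PAut_def BijGroup_def act mult)
  thus "group_action (PAut n M) {..<n} (row_act n)" "group_action (PAut n M) {..<n} (col_act n)"
    by (auto intro!: group_action.intro group_hom.intro group_hom_axioms.intro
        group_PAut M group_BijGroup)
qed

lemma row_sum_exists:
  fixes M :: "'a::field mat"
  assumes M: "M \<in> carrier_mat n n" and G: "subgroup G (PAut n M)"
    and R: "R \<in> row_orbits n M G" and C: "C \<in> col_orbits n M G"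
  shows "\<exists>!s. \<forall>x\<in>R. (\<Sum>y\<in>C. M $$ (x, y)) = s"
proof -
  note iff = PAut_carrier_iff[OF M]
  let ?H = "PAut n M\<lparr>carrier := G\<rparr>"
  have act: "group_action ?H {..<n} (row_act n)" "group_action ?H {..<n} (col_act n)"
    using group_action.induced_action[OF group_action_PAut(1)[OF M]]
      group_action.induced_action[OF group_action_PAut(2)[OF M]] G
    by auto
  interpret r: group_action ?H "{..<n}" "row_act n" by (rule act)
  interpret c: group_action ?H "{..<n}" "col_act n" by (rule act)
  obtain x0 where x0: "x0 < n" "R = orbit ?H (row_act n) x0"
    using R by (auto simp: row_orbits_def orbits_def)
  obtain y0 where y0: "y0 < n" "C = orbit ?H (col_act n) y0"
    using C by (auto simp: col_orbits_def orbits_def)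
  have C_lt: "y < n" if "y \<in> C" for y
    using that c.element_image y0 by (fastforce simp: orbit_def)
  have eq: "(\<Sum>y\<in>C. M $$ (x, y)) = (\<Sum>y\<in>C. M $$ (x0, y))" if xR: "x \<in> R" for x
  proof -
    obtain g where g: "g \<in> G" "x = row_act n g x0" using xR x0 unfolding orbit_def by auto
    have gc: "g \<in> carrier (PAut n M)" using g(1) G subgroup.subset by blast
    obtain p q where pq: "p permutes {..<n}" "q permutes {..<n}" "g = (perm_mat n p, perm_mat n q)"
      "\<forall>a<n. \<forall>b<n. M $$ (p a, q b) = M $$ (a, b)" using gc iff by blast
    have x: "x = p x0" using g(2) x0(1) by (simp add: pq row_act_def perm_mat_act_perm_mat)
    have col: "col_act n g = restrict q {..<n}" by (simp add: pq col_act_def perm_mat_act_perm_mat)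
    have "q ` C \<subseteq> C"
    proof
      fix z assume "z \<in> q ` C"
      then obtain y where y: "y \<in> C" "z = q y" by blast
      then obtain h where h: "h \<in> G" "y = col_act n h y0" using y0 unfolding orbit_def by auto
      have "z = col_act n g y" using y C_lt col by simp
      also have "\<dots> = col_act n (g \<otimes>\<^bsub>PAut n M\<^esub> h) y0"
        using c.composition_rule[of y0 g h] y0 g h by simp
      finally have z: "z = col_act n (g \<otimes>\<^bsub>PAut n M\<^esub> h) y0" .
      have "g \<otimes>\<^bsub>PAut n M\<^esub> h \<in> carrier ?H" using subgroup.m_closed[OF G g(1) h(1)] by simp
      thus "z \<in> C" unfolding y0(2) orbit_def z by blast
    qed
    moreover have "finite C" using C_lt by (meson finite_nat_iff_bounded subsetI lessThan_iff)
    moreover have inj: "inj_on q C" using permutes_inj[OF pq(2)] by (simp add: inj_on_def inj_def)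
    ultimately have "q ` C = C" by (simp add: endo_inj_surj)
    hence "(\<Sum>y\<in>C. M $$ (x, y)) = (\<Sum>y\<in>C. M $$ (x, q y))"
      using sum.reindex[OF inj, of "\<lambda>y. M $$ (x, y)"] by simp
    also have "\<dots> = (\<Sum>y\<in>C. M $$ (x0, y))"
      using pq(4) x0(1) C_lt x by (intro sum.cong) auto
    finally show ?thesis .
  qed
  have "x0 \<in> R" using x0 r.orbit_refl by simp
  show ?thesis
  proof (rule ex1I)
    show "\<forall>x\<in>R. (\<Sum>y\<in>C. M $$ (x, y)) = (\<Sum>y\<in>C. M $$ (x0, y))" using eq by blast
  next
    fix s assume s: "\<forall>x\<in>R. (\<Sum>y\<in>C. M $$ (x, y)) = s"
    show "s = (\<Sum>y\<in>C. M $$ (x0, y))" using bspec[OF s \<open>x0 \<in> R\<close>] by (rule sym)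
  qed
qed

text \<open>The blocks form a multiset: repeated blocks are allowed.\<close>

definition r_lambda_design :: "'p set \<Rightarrow> 'p set multiset \<Rightarrow> nat \<Rightarrow> nat \<Rightarrow> bool" where
  "r_lambda_design X \<B> r l \<longleftrightarrow>
     finite X \<and> (\<forall>\<beta>\<in>#\<B>. \<beta> \<subseteq> X) \<and>
     (\<forall>x\<in>X. size {#\<beta> \<in># \<B>. x \<in> \<beta>#} = r) \<and>
     (\<forall>x\<in>X. \<forall>y\<in>X. x \<noteq> y \<longrightarrow> size {#\<beta> \<in># \<B>. x \<in> \<beta> \<and> y \<in> \<beta>#} = l)"

definition incidence_matrix :: "'p list \<Rightarrow> 'p set list \<Rightarrow> 'a::field mat" where
  "incidence_matrix ps bs =
     mat (length ps) (length bs) (\<lambda>(i, j). if ps ! i \<in> bs ! j then 1 else 0)"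

definition append_cols :: "'a::zero mat \<Rightarrow> 'a mat \<Rightarrow> 'a mat" where
  "append_cols A B = four_block_mat A B (0\<^sub>m 0 (dim_col A)) (0\<^sub>m 0 (dim_col B))"

definition linear_code :: "nat \<Rightarrow> 'a::field vec set \<Rightarrow> bool" where
  "linear_code N C \<longleftrightarrow> VectorSpace.subspace class_ring C (module_vec TYPE('a) N)"

definition generated_code :: "'a::field mat \<Rightarrow> 'a vec set" where
  "generated_code A = vec_space.row_space (dim_col A) A"

definition herm_prod :: "'a::field vec \<Rightarrow> 'a vec \<Rightarrow> 'a" where
  "herm_prod u v = u \<bullet> star_vec v"

definition hermitian_dual :: "nat \<Rightarrow> 'a::field vec set \<Rightarrow> 'a vec set" where
  "hermitian_dual N C = {u \<in> carrier_vec N. \<forall>v\<in>C. herm_prod u v = 0}"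

definition hermitian_LCD :: "nat \<Rightarrow> 'a::field vec set \<Rightarrow> bool" where
  "hermitian_LCD N C \<longleftrightarrow> linear_code N C \<and> C \<inter> hermitian_dual N C = {0\<^sub>v N}"

end

theory Submission
  imports Defs
begin

text \<open>The fields in question are exactly those on which the involution is additive. Counting
  how often each field element occurs in a block shows that row sums and column sums of every
  orbit block agree; counting in the natural numbers keeps this valid when the characteristic
  divides the orbit length. Hence the row orbit matrix satisfies \<open>R R\<^sup>* = m I\<close>, so
  \<open>A A\<^sup>* = (r - \<lambda> + m) I + \<lambda> J\<close>, which is nonsingular by the two hypotheses. If \<open>x A\<close> lies in
  the Hermitian dual, then \<open>x A A\<^sup>* = 0\<close> and \<open>x = 0\<close>.\<close>

section \<open>The involution on fields of order 2, 3 and 4\<close>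

text \<open>Multiplication by \<open>x\<close> permutes the nonzero elements, so their product is
  unchanged when each factor is multiplied by \<open>x\<close>; it is nonzero and cancels.\<close>

lemma power_card_minus_one_eq_one:
  fixes x :: "'a::{field,finite}"
  assumes "x \<noteq> 0"
  shows "x ^ (card (UNIV :: 'a set) - 1) = 1"
proof -
  have "bij_betw ((*) x) (UNIV - {0}) (UNIV - {0})"
    by (rule bij_betw_byWitness[of _ "\<lambda>y. y / x"]) (use assms in auto)
  from prod.reindex_bij_betw[OF this, of "\<lambda>y. y"]
  have "x ^ (card (UNIV :: 'a set) - 1) * \<Prod>(UNIV - {0 :: 'a}) = \<Prod>(UNIV - {0})"
    by (simp add: prod.distrib card_Diff_singleton)
  thus ?thesis by simp
qed

text \<open>Translation by 1 permutes the ring, so adding 1 to every term leaves the sum of all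
  elements unchanged.\<close>

lemma of_nat_card_UNIV_eq_0: "of_nat (card (UNIV :: 'a::{ring_1,finite} set)) = (0 :: 'a)"
proof -
  have "bij (\<lambda>x :: 'a. x + 1)"
    by (rule bij_betw_byWitness[of _ "\<lambda>x. x - 1"]) auto
  from sum.reindex_bij_betw[OF this, of "\<lambda>x. x"] show ?thesis by (simp add: sum.distrib)
qed

lemma dagger_simps [simp]: "dagger 0 = 0" "dagger 1 = 1"
  by (simp_all add: dagger_def)

text \<open>For order 4 the involution is squaring, the Frobenius map in characteristic 2; for
  orders 2 and 3 it is the identity.\<close>

lemma dagger_add:
  fixes x y :: "'a::{field,finite}"
  assumes "card (UNIV :: 'a set) \<in> {2, 3, 4}"
  shows "dagger (x + y) = dagger x + dagger y"
proof (cases "card (UNIV :: 'a set) = 4")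
  case True
  \<comment> \<open>The field order 4 vanishes in the field, and a field has no zero
    divisors.\<close>
  have "(2 :: 'a) * 2 = 0" using of_nat_card_UNIV_eq_0[where 'a = 'a] True by simp
  hence 2: "(2 :: 'a) = 0" by (simp only: mult_eq_0_iff disj_absorb)
  have "dagger z = z ^ 2" for z :: 'a
  proof (cases "z = 0")
    case False
    hence "z * z ^ 2 = 1"
      using power_card_minus_one_eq_one[OF False] True by (simp flip: power_Suc)
    thus ?thesis using False by (simp add: dagger_def inverse_unique)
  qed simp
  thus ?thesis using 2 by (simp add: power2_sum)
next
  case False
  have "dagger z = z" for z :: 'a
  proof (cases "z = 0")
    case nz: False
    \<comment> \<open>The two alternatives are z^(q-1) = 1 for q = 2 and q = 3; either way z is its
      own inverse.\<close>
    have "z = 1 \<or> z ^ 2 = 1"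
      using power_card_minus_one_eq_one[OF nz] assms False by auto
    hence "z * z = 1" by (auto simp: power2_eq_square)
    thus ?thesis using nz by (simp add: dagger_def inverse_unique)
  qed simp
  thus ?thesis by simp
qed

lemma dagger_sum:
  fixes f :: "'b \<Rightarrow> 'a::{field,finite}"
  assumes "card (UNIV :: 'a set) \<in> {2, 3, 4}"
  shows "dagger (\<Sum>i\<in>I. f i) = (\<Sum>i\<in>I. dagger (f i))"
  by (induction I rule: infinite_finite_induct) (simp_all add: dagger_add[OF assms])

section \<open>Orbits of permutation automorphism groups\<close>

text \<open>A group element maps each orbit into itself injectively, and on a finite set this is
  already a bijection.\<close>

lemma (in group_action) bij_betw_orbit:
  assumes "finite E" "g \<in> carrier G" "X \<in> orbits G E \<phi>"
  shows "bij_betw (\<phi> g) X X"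
proof -
  have "X \<subseteq> E" using orbits_coverture assms(3) by blast
  hence X: "finite X" "inj_on (\<phi> g) X"
    using assms(1) inj_prop[OF assms(2)] by (auto intro: finite_subset inj_on_subset)
  obtain x where x: "x \<in> E" "X = orbit G \<phi> x" using assms(3) by (auto simp: orbits_def)
  have "\<phi> g ` X \<subseteq> X"
  proof
    fix z assume "z \<in> \<phi> g ` X"
    then obtain h where h: "h \<in> carrier G" "z = \<phi> g (\<phi> h x)" using x by (auto simp: orbit_def)
    hence "z = \<phi> (g \<otimes> h) x" using composition_rule x assms(2) by simp
    moreover have "g \<otimes> h \<in> carrier G"
      using group_hom assms(2) h(1) by (simp add: group_hom.axioms(1) group.is_monoid monoid.m_closed)
    ultimately show "z \<in> X" using x by (auto simp: orbit_def)
  qed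
  thus ?thesis using X by (simp add: bij_betw_def endo_inj_surj)
qed

lemma (in group_action) orbit_transitive:
  assumes "X \<in> orbits G E \<phi>" "x \<in> X" "y \<in> X"
  obtains g where "g \<in> carrier G" "\<phi> g x = y"
proof -
  obtain z where z: "z \<in> E" "X = orbit G \<phi> z" using assms(1) by (auto simp: orbits_def)
  have E: "x \<in> E" "y \<in> E" using orbits_coverture assms by blast+
  have "y \<in> orbit G \<phi> x"
    using orbit_trans[OF E(1) z(1) E(2)] orbit_sym[OF z(1) E(1)] assms z by simp
  thus ?thesis using that by (auto simp: orbit_def)
qed

lemma induced_action_PAut:
  fixes M :: "'a::field mat"
  assumes "M \<in> carrier_mat n n" "subgroup G (PAut n M)"
  shows "group_action (PAut n M\<lparr>carrier := G\<rparr>) {..<n} (row_act n)"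
    and "group_action (PAut n M\<lparr>carrier := G\<rparr>) {..<n} (col_act n)"
  using group_action.induced_action[OF group_action_PAut(1)[OF assms(1)]]
    group_action.induced_action[OF group_action_PAut(2)[OF assms(1)]] assms(2)
  by auto

lemma PAut_act_invariant:
  fixes M :: "'a::field mat"
  assumes "M \<in> carrier_mat n n" "g \<in> carrier (PAut n M)" "x < n" "y < n"
  shows "M $$ (row_act n g x, col_act n g y) = M $$ (x, y)"
  using assms by (auto simp: PAut_carrier_iff row_act_def col_act_def perm_mat_act_perm_mat)

locale permutation_automorphism_group =
  fixes n :: nat and M :: "'a::{field,finite} mat" and G :: "('a mat \<times> 'a mat) set"
  assumes M: "M \<in> carrier_mat n n" and G: "subgroup G (PAut n M)"
begin

sublocale row: group_action "PAut n M\<lparr>carrier := G\<rparr>" "{..<n}" "row_act n"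
  by (rule induced_action_PAut[OF M G])

sublocale col: group_action "PAut n M\<lparr>carrier := G\<rparr>" "{..<n}" "col_act n"
  by (rule induced_action_PAut[OF M G])

lemma orbit_subset:
  "R \<in> row_orbits n M G \<Longrightarrow> R \<subseteq> {..<n}" "C \<in> col_orbits n M G \<Longrightarrow> C \<subseteq> {..<n}"
  using row.orbits_coverture col.orbits_coverture unfolding row_orbits_def col_orbits_def by blast+

lemma act_bij_betw_orbit:
  assumes "g \<in> G"
  shows "R \<in> row_orbits n M G \<Longrightarrow> bij_betw (row_act n g) R R"
    and "C \<in> col_orbits n M G \<Longrightarrow> bij_betw (col_act n g) C C"
  using row.bij_betw_orbit col.bij_betw_orbit assms by (simp_all add: row_orbits_def col_orbits_def)

lemma act_invariant:
  assumes "g \<in> G" "x < n" "y < n"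
  shows "M $$ (row_act n g x, col_act n g y) = M $$ (x, y)"
  using PAut_act_invariant[OF M] assms subgroup.subset[OF G] by blast

section \<open>Row and column sums of an orbit block\<close>

text \<open>A group element taking row \<open>x\<close> to row \<open>x'\<close> permutes the
  columns of \<open>C\<close> and preserves entries, so it carries the positions of the value
  \<open>a\<close> in one row to those in the other.\<close>

lemma card_row_entries:
  assumes R: "R \<in> row_orbits n M G" and C: "C \<in> col_orbits n M G" and x: "x \<in> R" "x' \<in> R"
  shows "card {y \<in> C. M $$ (x, y) = a} = card {y \<in> C. M $$ (x', y) = a}"
proof -
  obtain g where g: "g \<in> G" "row_act n g x = x'"
    using row.orbit_transitive[of R x x'] R x by (auto simp: row_orbits_def)
  have "M $$ (x', col_act n g y) = M $$ (x, y)" if "y \<in> C" for y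
    using act_invariant[of g x y] g orbit_subset R C x that by blast
  hence "bij_betw (col_act n g) {y \<in> C. M $$ (x, y) = a} {y \<in> C. M $$ (x', y) = a}"
    by (intro bij_betw_Collect[OF act_bij_betw_orbit(2)[OF g(1) C]]) simp
  thus ?thesis by (rule bij_betw_same_card)
qed

lemma card_col_entries:
  assumes R: "R \<in> row_orbits n M G" and C: "C \<in> col_orbits n M G" and y: "y \<in> C" "y' \<in> C"
  shows "card {x \<in> R. M $$ (x, y) = a} = card {x \<in> R. M $$ (x, y') = a}"
proof -
  obtain g where g: "g \<in> G" "col_act n g y = y'"
    using col.orbit_transitive[of C y y'] C y by (auto simp: col_orbits_def)
  have "M $$ (row_act n g x, y') = M $$ (x, y)" if "x \<in> R" for x
    using act_invariant[of g x y] g orbit_subset R C y that by blast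
  hence "bij_betw (row_act n g) {x \<in> R. M $$ (x, y) = a} {x \<in> R. M $$ (x, y') = a}"
    by (intro bij_betw_Collect[OF act_bij_betw_orbit(1)[OF g(1) R]]) simp
  thus ?thesis by (rule bij_betw_same_card)
qed

text \<open>Both sums are determined by how often each field element occurs. Counting the positions
  of a value \<open>a\<close> in the block by rows and by columns shows that these multiplicities
  agree.\<close>

lemma row_sum_eq_col_sum:
  assumes R: "R \<in> row_orbits n M G" and C: "C \<in> col_orbits n M G" and RC: "card R = card C"
    and x: "x \<in> R" and y: "y \<in> C"
  shows "(\<Sum>y'\<in>C. M $$ (x, y')) = (\<Sum>x'\<in>R. M $$ (x', y))"
proof -
  have fin: "finite R" "finite C" using orbit_subset R C by (auto intro: finite_subset)
  have "card {y' \<in> C. M $$ (x, y') = a} = card {x' \<in> R. M $$ (x', y) = a}" for a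
  proof -
    have "card R * card {y' \<in> C. M $$ (x, y') = a} = (\<Sum>x'\<in>R. card {y' \<in> C. M $$ (x, y') = a})"
      by simp
    also have "\<dots> = (\<Sum>x'\<in>R. card {y' \<in> C. M $$ (x', y') = a})"
      by (intro sum.cong refl card_row_entries[OF R C x])
    also have "\<dots> = (\<Sum>y'\<in>C. card {x' \<in> R. M $$ (x', y') = a})"
      using sum_multicount_gen[OF fin, of "\<lambda>x' y'. M $$ (x', y') = a"
          "\<lambda>y'. card {x' \<in> R. M $$ (x', y') = a}"] by simp
    also have "\<dots> = (\<Sum>y'\<in>C. card {x' \<in> R. M $$ (x', y) = a})"
      by (intro sum.cong refl card_col_entries[OF R C _ y])
    \<comment> \<open>The common orbit length is a positive natural number, since \<open>y\<close>
      lies in \<open>C\<close>, and hence cancels.\<close>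
    finally show ?thesis using RC fin y by auto
  qed
  moreover have "(\<Sum>z\<in>Z. f z) = (\<Sum>a\<in>UNIV. of_nat (card {z \<in> Z. f z = a}) * a)"
    if "finite Z" for Z and f :: "nat \<Rightarrow> 'a"
    by (rule sum_fun_comp[OF that finite_UNIV subset_UNIV])
  ultimately show ?thesis using fin by simp
qed

section \<open>The Gram matrix of the row orbit matrix\<close>

text \<open>By \<open>row_sum_exists\<close> the definite description denotes the common row sum, so
  any row of the orbit may serve as representative.\<close>

lemma row_orbit_matrix_index:
  assumes "bij_betw \<R> {..<t} (row_orbits n M G)" "bij_betw \<C> {..<t} (col_orbits n M G)"
    and ij: "i < t" "j < t" and x: "x \<in> \<R> i"
  shows "row_orbit_matrix t \<R> \<C> M $$ (i, j) = (\<Sum>y\<in>\<C> j. M $$ (x, y))"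
proof -
  have "\<R> i \<in> row_orbits n M G" "\<C> j \<in> col_orbits n M G"
    using assms by (auto dest: bij_betwE)
  from bspec[OF theI'[OF row_sum_exists[OF M G this]] x, symmetric] show ?thesis
    unfolding row_orbit_matrix_def by (simp only: index_mat(1)[OF ij] prod.case)
qed

text \<open>Fix a row \<open>x1\<close> of orbit j. Writing the first factor as a column sum and the
  second as the sum of row \<open>x1\<close> turns the product into a sum over one block. The column
  orbits partition all columns, so summing over s leaves the inner products of \<open>x1\<close>
  with the rows of orbit i; only \<open>x1\<close> itself contributes, and only if i = j.\<close>

lemma row_orbit_matrix_gram:
  assumes W: "weighing_matrix n m M" and q: "card (UNIV :: 'a set) \<in> {2, 3, 4}"
    and \<R>: "bij_betw \<R> {..<t} (row_orbits n M G)" and \<C>: "bij_betw \<C> {..<t} (col_orbits n M G)"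
    and k: "\<forall>X\<in>row_orbits n M G \<union> col_orbits n M G. card X = k"
    and ij: "i < t" "j < t"
  defines "R \<equiv> row_orbit_matrix t \<R> \<C> M"
  shows "(\<Sum>s<t. R $$ (i, s) * dagger (R $$ (j, s))) = (if i = j then of_nat m else 0)"
proof -
  have \<R>in: "\<R> a \<in> row_orbits n M G" and \<C>in: "\<C> a \<in> col_orbits n M G" if "a < t" for a
    using that \<R> \<C> by (auto dest: bij_betwE)
  have rows: "(\<Sum>y<n. M $$ (x, y) * dagger (M $$ (x', y))) = (if x = x' then of_nat m else 0)"
    if "x < n" "x' < n" for x x'
  proof -
    have "(M * star_mat M) $$ (x, x') = (of_nat m \<cdot>\<^sub>m 1\<^sub>m n) $$ (x, x')"
      using W by (simp add: weighing_matrix_def)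
    thus ?thesis using that M by (simp add: star_mat_def scalar_prod_def lessThan_atLeast0)
  qed
  have ne: "X \<noteq> {}" if "X \<in> row_orbits n M G" for X
    using that row.orbit_refl by (auto simp: row_orbits_def orbits_def)
  obtain x0 x1 where x0: "x0 \<in> \<R> i" and x1: "x1 \<in> \<R> j"
    using ne \<R>in ij by (meson ex_in_conv)
  have lt: "x < n" if "x \<in> \<R> a" "a < t" for x a using orbit_subset \<R>in that by blast
  have "R $$ (i, s) * dagger (R $$ (j, s)) =
      (\<Sum>y\<in>\<C> s. \<Sum>x\<in>\<R> i. M $$ (x, y) * dagger (M $$ (x1, y)))" if s: "s < t" for s
  proof -
    \<comment> \<open>Since any column \<open>y\<close> of the orbit may be chosen, the column can
      be matched with the summation index of the other factor.\<close>
    have "R $$ (i, s) = (\<Sum>x\<in>\<R> i. M $$ (x, y))" if "y \<in> \<C> s" for y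
      unfolding R_def row_orbit_matrix_index[OF \<R> \<C> ij(1) s x0]
      by (rule row_sum_eq_col_sum) (use \<R>in \<C>in ij s that x0 k in auto)
    moreover have "R $$ (j, s) = (\<Sum>y\<in>\<C> s. M $$ (x1, y))"
      unfolding R_def by (rule row_orbit_matrix_index[OF \<R> \<C> ij(2) s x1])
    ultimately show ?thesis
      by (simp add: dagger_sum[OF q] sum_distrib_left sum_distrib_right[symmetric])
  qed
  hence "(\<Sum>s<t. R $$ (i, s) * dagger (R $$ (j, s))) =
      (\<Sum>s<t. \<Sum>y\<in>\<C> s. \<Sum>x\<in>\<R> i. M $$ (x, y) * dagger (M $$ (x1, y)))" by simp
  also have "\<dots> = (\<Sum>X\<in>col_orbits n M G. \<Sum>y\<in>X. \<Sum>x\<in>\<R> i. M $$ (x, y) * dagger (M $$ (x1, y)))"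
    using sum.reindex_bij_betw[OF \<C>,
        of "\<lambda>X. \<Sum>y\<in>X. \<Sum>x\<in>\<R> i. M $$ (x, y) * dagger (M $$ (x1, y))"] by simp
  also have "\<dots> = (\<Sum>y<n. \<Sum>x\<in>\<R> i. M $$ (x, y) * dagger (M $$ (x1, y)))"
    using col.disjoint_sum by (simp add: col_orbits_def)
  also have "\<dots> = (\<Sum>x\<in>\<R> i. if x = x1 then of_nat m else 0)"
    by (subst sum.swap) (use rows lt ij x1 in simp)
  also have "\<dots> = (if x1 \<in> \<R> i then of_nat m else 0)"
    using orbit_subset \<R>in ij by (simp add: sum.delta finite_subset[of _ "{..<n}"])
  also have "x1 \<in> \<R> i \<longleftrightarrow> i = j"
  proof
    assume "x1 \<in> \<R> i"
    hence "\<R> i = \<R> j"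
      using row.disjoint_union[of "\<R> i" "\<R> j"] \<R>in ij x1 by (auto simp: row_orbits_def)
    thus "i = j" using \<R> ij by (auto simp: bij_betw_def inj_on_def)
  qed (use x1 in simp)
  finally show ?thesis .
qed

end

section \<open>Gram matrices of the design and of adjoined columns\<close>

text \<open>The entries 0 and 1 are fixed by the involution, so the sum counts, with multiplicity,
  the blocks through both points. Distinctness of \<open>ps\<close> makes different indices
  different points.\<close>

lemma incidence_matrix_gram:
  assumes "r_lambda_design (set ps) (mset bs) r l" "distinct ps"
    and ij: "i < length ps" "j < length ps"
  defines "B \<equiv> incidence_matrix ps bs :: 'a::field mat"
  shows "(\<Sum>s<length bs. B $$ (i, s) * dagger (B $$ (j, s))) = (if i = j then of_nat r else of_nat l)"
proof -
  let ?P = "\<lambda>\<beta>. ps ! i \<in> \<beta> \<and> ps ! j \<in> \<beta>"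
  have "(\<Sum>s<length bs. B $$ (i, s) * dagger (B $$ (j, s))) =
      (\<Sum>s<length bs. if ?P (bs ! s) then 1 else 0)"
    using ij by (intro sum.cong) (auto simp: B_def incidence_matrix_def)
  also have "\<dots> = of_nat (card {s. s < length bs \<and> ?P (bs ! s)})"
    by (simp add: sum.If_cases Int_def)
  also have "card {s. s < length bs \<and> ?P (bs ! s)} = size (filter_mset ?P (mset bs))"
    by (simp add: length_filter_conv_card flip: mset_filter)
  also have "\<dots> = (if i = j then r else l)"
    using assms by (auto simp: r_lambda_design_def nth_eq_iff_index_eq)
  finally show ?thesis by simp
qed

lemma append_cols_gram:
  fixes P Q :: "'a::field mat"
  assumes "P \<in> carrier_mat t a" "Q \<in> carrier_mat t b" "i < t" "j < t"
  shows "(\<Sum>s<a + b. append_cols P Q $$ (i, s) * dagger (append_cols P Q $$ (j, s))) =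
    (\<Sum>s<a. P $$ (i, s) * dagger (P $$ (j, s))) + (\<Sum>s<b. Q $$ (i, s) * dagger (Q $$ (j, s)))"
proof -
  have "{..<a + b} = {..<a} \<union> (+) a ` {..<b}"
    unfolding lessThan_atLeast0 image_add_atLeastLessThan by auto
  hence "(\<Sum>s<a + b. append_cols P Q $$ (i, s) * dagger (append_cols P Q $$ (j, s))) =
      (\<Sum>s<a. append_cols P Q $$ (i, s) * dagger (append_cols P Q $$ (j, s))) +
      (\<Sum>s\<in>(+) a ` {..<b}. append_cols P Q $$ (i, s) * dagger (append_cols P Q $$ (j, s)))"
    by (simp only:) (rule sum.union_disjoint; auto)
  thus ?thesis using assms by (simp add: sum.reindex append_cols_def)
qed

section \<open>A Gram matrix criterion for LCD codes\<close>

text \<open>The Gram matrix is \<alpha> I + \<mu> J with J all-ones. It is nonsingular because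
  \<alpha> and \<alpha> + t \<mu> are nonzero, so a coefficient vector it annihilates must
  vanish.\<close>

lemma hermitian_LCD_if_gram:
  fixes A :: "'a::field mat"
  assumes A: "A \<in> carrier_mat t N"
    and gram: "\<And>i j. i < t \<Longrightarrow> j < t \<Longrightarrow>
      (\<Sum>s<N. A $$ (i, s) * dagger (A $$ (j, s))) = (if i = j then \<alpha> else 0) + \<mu>"
    and nz: "\<alpha> \<noteq> 0" "\<alpha> + of_nat t * \<mu> \<noteq> 0"
  shows "hermitian_LCD N (generated_code A)"
proof -
  interpret vec_space "TYPE('a)" N .
  have C: "generated_code A = row_space A" using A by (simp add: generated_code_def)
  have rows: "set (rows A) \<subseteq> carrier_vec N" using A by (auto simp: rows_def)
  have sub: "subspace class_ring (row_space A) V"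
    unfolding row_space_def using rows by (rule span_is_subspace)
  have "u = 0\<^sub>v N" if u: "u \<in> row_space A" "u \<in> hermitian_dual N (row_space A)" for u
  proof -
    obtain x where x: "x \<in> carrier_vec t" "u = A\<^sup>T *\<^sub>v x"
      using u(1) A unfolding row_space_eq[OF A] by auto
    have us: "u $ s = (\<Sum>i<t. A $$ (i, s) * x $ i)" if "s < N" for s
      using x A that by (simp add: scalar_prod_def lessThan_atLeast0)
    let ?S = "\<Sum>i<t. x $ i"
    have eq: "\<alpha> * x $ j + \<mu> * ?S = 0" if j: "j < t" for j
    proof -
      \<comment> \<open>Pairing \<open>u\<close> with each generator gives one equation per row. The
        involution acts only on the second argument, so expanding \<open>u\<close> in the rows of
        \<open>A\<close> is linear.\<close>
      have "row A j \<in> row_space A"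
        unfolding row_space_def using rows A j by (intro subsetD[OF in_own_span]) (auto simp: rows_def)
      hence "0 = herm_prod u (row A j)" using u(2) by (simp add: hermitian_dual_def)
      also have "\<dots> = (\<Sum>s<N. u $ s * dagger (A $$ (j, s)))"
        using A j by (simp add: herm_prod_def star_vec_def scalar_prod_def lessThan_atLeast0)
      also have "\<dots> = (\<Sum>s<N. \<Sum>i<t. x $ i * (A $$ (i, s) * dagger (A $$ (j, s))))"
        by (intro sum.cong refl) (simp add: us sum_distrib_left mult_ac)
      also have "\<dots> = (\<Sum>i<t. x $ i * (\<Sum>s<N. A $$ (i, s) * dagger (A $$ (j, s))))"
        by (subst sum.swap) (simp add: sum_distrib_left)
      also have "\<dots> = (\<Sum>i<t. (if i = j then \<alpha> * x $ i else 0) + \<mu> * x $ i)"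
        using j by (intro sum.cong refl) (simp add: gram algebra_simps)
      also have "\<dots> = \<alpha> * x $ j + \<mu> * ?S"
        using j by (simp add: sum.distrib sum_distrib_left)
      finally show ?thesis by simp
    qed
    \<comment> \<open>Adding the t equations isolates the coefficient sum \<open>?S\<close>; once it
      is zero, each equation reduces to \<alpha> x_j = 0.\<close>
    have "0 = (\<Sum>j<t. \<alpha> * x $ j + \<mu> * ?S)" using eq by simp
    also have "\<dots> = (\<alpha> + of_nat t * \<mu>) * ?S"
      by (simp add: sum.distrib sum_distrib_left[symmetric] algebra_simps)
    finally have "?S = 0" using nz(2) by simp
    hence "x $ j = 0" if "j < t" for j using eq[OF that] nz(1) by simp
    thus ?thesis using us x A by (intro eq_vecI) auto
  qed
  moreover have "0\<^sub>v N \<in> row_space A"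
    unfolding row_space_eq[OF A] using A by (auto intro!: bexI[of _ "0\<^sub>v t"] eq_vecI)
  moreover have "0\<^sub>v N \<in> hermitian_dual N (row_space A)"
    using span_closed[OF rows]
    by (auto simp: hermitian_dual_def herm_prod_def star_vec_def row_space_def)
  ultimately have "row_space A \<inter> hermitian_dual N (row_space A) = {0\<^sub>v N}" by blast
  thus ?thesis unfolding hermitian_LCD_def linear_code_def C by (intro conjI sub)
qed

section \<open>The Gram matrix of the extended orbit matrix\<close>

theorem theorem5p1:
  fixes W R B A :: "'a::{field,finite} mat"
    and G :: "('a mat \<times> 'a mat) set"
    and \<R> \<C> :: "nat \<Rightarrow> nat set"
    and ps :: "'p list" and bs :: "'p set list"
    and q n m t b r l k :: nat
  assumes "card (UNIV :: 'a set) = q" and "q \<in> {2, 3, 4}"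
    and "weighing_matrix n m W"
    and "subgroup G (PAut n W)"
    and "bij_betw \<R> {..<t} (row_orbits n W G)"
    and "bij_betw \<C> {..<t} (col_orbits n W G)"
    and "\<forall>X\<in>row_orbits n W G \<union> col_orbits n W G. card X = k"
    and "distinct ps" and "length ps = t" and "length bs = b"
    and "r_lambda_design (set ps) (mset bs) r l"
    and "B = incidence_matrix ps bs"
    and "R = row_orbit_matrix t \<R> \<C> W"
    and "of_nat r + (of_nat t - 1) * of_nat l + of_nat m \<noteq> (0::'a)"
    and "of_nat r - of_nat l + of_nat m \<noteq> (0::'a)"
    and "A = append_cols R B"
  shows "hermitian_LCD (t + b) (generated_code A)"
proof -
  have W: "W \<in> carrier_mat n n" using assms(3) by (simp add: weighing_matrix_def)
  interpret permutation_automorphism_group n W G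
    using W assms(4) by (rule permutation_automorphism_group.intro)
  have R: "R \<in> carrier_mat t t" by (simp add: assms(13) row_orbit_matrix_def)
  have B: "B \<in> carrier_mat t b" using assms(9,10,12) by (simp add: incidence_matrix_def)
  show ?thesis
  \<comment> \<open>The orbit matrix contributes m I and the design (r - l) I + l J. With these
    values \<alpha> + t \<mu> rearranges to r + (t - 1) l + m, computed in the field.\<close>
  proof (rule hermitian_LCD_if_gram[where \<alpha> = "of_nat r - of_nat l + of_nat m" and \<mu> = "of_nat l"])
    show "A \<in> carrier_mat t (t + b)"
      unfolding assms(16) append_cols_def using R B by (intro carrier_matI) auto
    show "(of_nat r - of_nat l + of_nat m :: 'a) \<noteq> 0" by (rule assms)
    show "(of_nat r - of_nat l + of_nat m :: 'a) + of_nat t * of_nat l \<noteq> 0"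
      using assms(14) by (simp add: algebra_simps)
    fix i j assume ij: "i < t" "j < t"
    have "(\<Sum>s<t. R $$ (i, s) * dagger (R $$ (j, s))) = (if i = j then of_nat m else 0)"
      unfolding assms(13) using assms(1,2,3,5,6,7) ij by (intro row_orbit_matrix_gram) auto
    moreover have "(\<Sum>s<b. B $$ (i, s) * dagger (B $$ (j, s))) = (if i = j then of_nat r else of_nat l)"
      using incidence_matrix_gram[OF assms(11,8), of i j] ij by (simp add: assms(9,10,12))
    ultimately show "(\<Sum>s<t + b. A $$ (i, s) * dagger (A $$ (j, s))) =
        (if i = j then of_nat r - of_nat l + of_nat m else 0) + of_nat l"
      unfolding assms(16) append_cols_gram[OF R B ij] by simp
  qed
qed

end
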